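(* Let $(V,q)$ be a Minkowski space whose dimension is greater than $3$, and let $\phi:V\to V$ be a continuous coherency preserver. Then either $\phi$ preserves adjacency, or $\phi$ is degenerate.
   Context: A Minkowski space is a pair $(V,q)$ where $V$ is a finite-dimensional real vector space of dimension $n>1$ and $q$ is a quadratic form on $V$ of signature $(1,n-1)$; $V$ carries its standard topology. Two points $x,y\in V$ are coherent when $q(x-y)=0$, and adjacent when they are coherent and $x\neq y$. For $a\in V$, the coherency cone of $a$ is $\mathcal{C}(a)=\{m\in V: q(m-a)=0\}$. A coherency preserver is a map $\phi:V\to V$ such that whenever $a,b$ are coherent, $\phi(a),\phi(b)$ are coherent; it is degenerate when its range is included in some coherency cone. A map preserves adjacency when it maps every pair of adjacent points to a pair of adjacent points. *)

theory Defs
  imports "HOL-Analysis.Analysis"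
begin

definition quadratic_form :: "('a::real_vector \<Rightarrow> real) \<Rightarrow> bool" where
  "quadratic_form q \<longleftrightarrow>
     (\<exists>B. bilinear B \<and> (\<forall>x y. B x y = B y x) \<and> (\<forall>x. q x = B x x))"

definition has_signature_1_nm1 :: "('a::euclidean_space \<Rightarrow> real) \<Rightarrow> bool" where
  "has_signature_1_nm1 q \<longleftrightarrow>
     (\<exists>e :: nat \<Rightarrow> 'a.
        inj_on e {..<DIM('a)} \<and> independent (e ` {..<DIM('a)}) \<and> span (e ` {..<DIM('a)}) = UNIV \<and>
        (\<forall>c :: nat \<Rightarrow> real.
           q (\<Sum>i<DIM('a). c i *\<^sub>R e i) = (c 0)\<^sup>2 - (\<Sum>i\<in>{1..<DIM('a)}. (c i)\<^sup>2)))"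

definition minkowski_space :: "('a::euclidean_space \<Rightarrow> real) \<Rightarrow> bool" where
  "minkowski_space q \<longleftrightarrow> DIM('a) > 1 \<and> quadratic_form q \<and> has_signature_1_nm1 q"

definition coherent :: "('a::real_vector \<Rightarrow> real) \<Rightarrow> 'a \<Rightarrow> 'a \<Rightarrow> bool" where
  "coherent q x y \<longleftrightarrow> q (x - y) = 0"

definition adjacent :: "('a::real_vector \<Rightarrow> real) \<Rightarrow> 'a \<Rightarrow> 'a \<Rightarrow> bool" where
  "adjacent q x y \<longleftrightarrow> coherent q x y \<and> x \<noteq> y"

definition coherency_cone :: "('a::real_vector \<Rightarrow> real) \<Rightarrow> 'a \<Rightarrow> 'a set" where
  "coherency_cone q a = {m. q (m - a) = 0}"

definition coherency_preserver :: "('a::real_vector \<Rightarrow> real) \<Rightarrow> ('a \<Rightarrow> 'a) \<Rightarrow> bool" where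
  "coherency_preserver q \<phi> \<longleftrightarrow> (\<forall>a b. coherent q a b \<longrightarrow> coherent q (\<phi> a) (\<phi> b))"

definition degenerate :: "('a::real_vector \<Rightarrow> real) \<Rightarrow> ('a \<Rightarrow> 'a) \<Rightarrow> bool" where
  "degenerate q \<phi> \<longleftrightarrow> (\<exists>a. range \<phi> \<subseteq> coherency_cone q a)"

definition preserves_adjacency :: "('a::real_vector \<Rightarrow> real) \<Rightarrow> ('a \<Rightarrow> 'a) \<Rightarrow> bool" where
  "preserves_adjacency q \<phi> \<longleftrightarrow> (\<forall>a b. adjacent q a b \<longrightarrow> adjacent q (\<phi> a) (\<phi> b))"

end

theory Submission
  imports Defs
begin

text \<open>
  Suppose that \<open>\<phi>\<close> identifies two adjacent points \<open>a\<close> and \<open>b\<close>, and that \<open>\<phi> x\<close> is off the cone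
  of \<open>\<phi> a\<close>. A lightlike line through \<open>x\<close> meets the cones of \<open>a\<close> and \<open>b\<close> in points with the
  same image, because a lightlike line through \<open>\<phi> x\<close> meets the cone of \<open>\<phi> a\<close> at most once. If
  \<open>y\<close> and \<open>y'\<close> are nearby points of the intersection of the cones of \<open>a\<close> and \<open>x\<close>, then for
  generic \<open>y\<close> some \<open>z\<close> on the cone of \<open>b\<close> is coherent to both and satisfies \<open>\<phi> z \<noteq> \<phi> a\<close>. The
  images of \<open>y\<close> and \<open>y'\<close> then lie on the lightlike line through \<open>\<phi> a\<close> and \<open>\<phi> z\<close>, so they
  coincide. Generic points of the intersection are joined by arcs of lightlike directions that
  have only finitely many non-generic directions; where the line through \<open>x\<close> misses the cone
  of \<open>a\<close>, it meets the cone of \<open>b\<close>, which provides the continuity needed to conclude that \<open>\<phi>\<close>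
  is constant along the arc. If \<open>w\<close> is the constant value, then \<open>\<phi>\<close> maps the cone of \<open>x\<close> into
  the lightlike line through \<open>\<phi> x\<close> and \<open>w\<close>. Since any point is coherent to some point of the
  cone of \<open>x\<close>, the range of \<open>\<phi>\<close> lies in the cone of \<open>w\<close>.
\<close>

lemma eventually_at_not_in_finite:
  fixes t0 :: "'a::t1_space"
  assumes "finite S"
  shows "\<forall>\<^sub>F t in at t0. t \<notin> S"
  using islimpt_finite[OF assms] islimpt_iff_eventually by blast

lemma eventually_constant_imp_eq_endpoints:
  fixes g :: "real \<Rightarrow> 'a::banach"
  assumes "a \<le> b" "finite K" and cont: "continuous_on {a..b} g"
    and const: "\<And>s. s \<in> {a..b} - K \<Longrightarrow> \<forall>\<^sub>F t in at s. g t = g s"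
  shows "g b = g a"
proof (rule has_derivative_zero_unique_strong_interval[OF assms(2) cont refl])
  show "(g has_derivative (\<lambda>h. 0)) (at s within {a..b})" if "s \<in> {a..b} - K" for s
  proof (rule has_derivative_at_withinI)
    have "\<forall>\<^sub>F t in at s. g s = g t"
      using const[OF that] by (rule eventually_mono) simp
    thus "(g has_derivative (\<lambda>h. 0)) (at s)"
      by (intro has_derivative_transform_eventually[OF has_derivative_const]) auto
  qed
qed (use \<open>a \<le> b\<close> in auto)

lemma eventually_root_between:
  fixes H :: "'b \<Rightarrow> real \<Rightarrow> real"
  assumes cont: "\<forall>\<^sub>F t in F. continuous_on {a..b} (H t)" and "a \<le> b"
    and a: "((\<lambda>t. H t a) \<longlongrightarrow> l) F" and b: "((\<lambda>t. H t b) \<longlongrightarrow> u) F" and "l * u < 0"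
  shows "\<forall>\<^sub>F t in F. \<exists>k\<in>{a..b}. H t k = 0"
proof -
  have "((\<lambda>t. H t a * H t b) \<longlongrightarrow> l * u) F" by (intro tendsto_mult a b)
  hence "\<forall>\<^sub>F t in F. H t a * H t b < 0" using \<open>l * u < 0\<close> by (rule order_tendstoD)
  with cont show ?thesis
  proof eventually_elim
    case (elim t)
    then consider "H t a \<le> 0" "0 \<le> H t b" | "H t b \<le> 0" "0 \<le> H t a"
      by (auto simp: mult_less_0_iff)
    thus ?case
      using IVT'[of "H t" a 0 b] IVT2'[of "H t" b 0 a] elim(1) \<open>a \<le> b\<close> by cases fastforce+
  qed
qed

lemma eventually_dilation_in_open:
  fixes t0 :: real
  assumes "open I" "t0 \<in> I"
  shows "\<forall>\<^sub>F t in at t0. \<forall>k\<in>{l..u}. t0 + k * (t - t0) \<in> I"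
proof -
  define M where "M = max \<bar>l\<bar> \<bar>u\<bar> + 1"
  obtain d where d: "d > 0" "ball t0 d \<subseteq> I" using assms openE by blast
  have M: "M > 0" by (simp add: M_def)
  have "\<forall>\<^sub>F t in at t0. dist t t0 < d / M"
    unfolding eventually_at using d(1) M by (intro exI[of _ "d / M"]) auto
  thus ?thesis
  proof (eventually_elim, intro ballI)
    fix t k assume t: "dist t t0 < d / M" and "k \<in> {l..u}"
    hence "\<bar>k\<bar> \<le> M" by (auto simp: M_def)
    hence "\<bar>k * (t - t0)\<bar> \<le> M * \<bar>t - t0\<bar>" by (simp add: abs_mult mult_right_mono)
    also have "\<dots> < d" using t M by (simp add: dist_real_def pos_less_divide_eq mult.commute)
    finally show "t0 + k * (t - t0) \<in> I" using d(2) by (auto simp: subset_iff dist_real_def)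
  qed
qed

lemma tendsto_rescaled_balance:
  fixes \<alpha> \<beta> :: "real \<Rightarrow> real"
  assumes "isCont \<alpha> t0" "isCont \<beta> t0" "c \<noteq> 0"
  shows "((\<lambda>t. c * (\<alpha> t0 * k\<^sup>2 - \<alpha> t * (1 - k)\<^sup>2) + 2 * \<alpha> t0 * \<alpha> t * \<beta> (t0 + k * (t - t0)))
    \<longlongrightarrow> 2 * c * \<alpha> t0 * (k - (1 / 2 - \<alpha> t0 * \<beta> t0 / c))) (at t0)"
proof -
  have "((\<lambda>t. t0 + k * (t - t0)) \<longlongrightarrow> t0 + k * (t0 - t0)) (at t0)" by (intro tendsto_intros)
  hence "((\<lambda>t. \<beta> (t0 + k * (t - t0))) \<longlongrightarrow> \<beta> t0) (at t0)"
    by (intro isCont_tendsto_compose[OF assms(2)]) simp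
  moreover have "(\<alpha> \<longlongrightarrow> \<alpha> t0) (at t0)" using assms(1) by (simp add: isCont_def)
  ultimately have "((\<lambda>t. c * (\<alpha> t0 * k\<^sup>2 - \<alpha> t * (1 - k)\<^sup>2)
        + 2 * \<alpha> t0 * \<alpha> t * \<beta> (t0 + k * (t - t0)))
      \<longlongrightarrow> c * (\<alpha> t0 * k\<^sup>2 - \<alpha> t0 * (1 - k)\<^sup>2) + 2 * \<alpha> t0 * \<alpha> t0 * \<beta> t0) (at t0)"
    by (intro tendsto_intros)
  moreover have "c * (\<alpha> t0 * k\<^sup>2 - \<alpha> t0 * (1 - k)\<^sup>2) + 2 * \<alpha> t0 * \<alpha> t0 * \<beta> t0
      = 2 * c * \<alpha> t0 * (k - (1 / 2 - \<alpha> t0 * \<beta> t0 / c))"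
    using \<open>c \<noteq> 0\<close> by (simp add: field_simps power2_eq_square)
  ultimately show ?thesis by simp
qed

lemma eventually_quadratic_balance:
  fixes \<alpha> \<beta> :: "real \<Rightarrow> real"
  assumes \<alpha>: "isCont \<alpha> t0" "\<alpha> t0 \<noteq> 0" and "c \<noteq> 0"
    and I: "open I" "t0 \<in> I" and \<beta>: "continuous_on I \<beta>"
  shows "\<forall>\<^sub>F t in at t0. \<exists>\<tau>\<in>I.
           c * (\<alpha> t0 * (t0 - \<tau>)\<^sup>2 - \<alpha> t * (t - \<tau>)\<^sup>2) = - 2 * \<alpha> t0 * \<alpha> t * (t0 - t)\<^sup>2 * \<beta> \<tau>"
proof -
  \<comment> \<open>Substituting \<open>\<tau> = t0 + k * (t - t0)\<close> and dividing by \<open>(t0 - t)\<^sup>2\<close> leaves an equation in \<open>k\<close>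
     that becomes linear, with root \<open>m\<close>, as \<open>t\<close> tends to \<open>t0\<close>.\<close>
  define m where "m = 1 / 2 - \<alpha> t0 * \<beta> t0 / c"
  define H where "H t k = c * (\<alpha> t0 * k\<^sup>2 - \<alpha> t * (1 - k)\<^sup>2)
      + 2 * \<alpha> t0 * \<alpha> t * \<beta> (t0 + k * (t - t0))" for t k
  have "isCont \<beta> t0" using \<beta> I by (simp add: continuous_on_eq_continuous_at)
  hence lim: "((\<lambda>t. H t k) \<longlongrightarrow> 2 * c * \<alpha> t0 * (k - m)) (at t0)" for k
    unfolding H_def m_def using \<alpha>(1) \<open>c \<noteq> 0\<close> by (intro tendsto_rescaled_balance)
  have "2 * c * \<alpha> t0 * (m - 1 - m) * (2 * c * \<alpha> t0 * (m + 1 - m)) = - (2 * c * \<alpha> t0)\<^sup>2"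
    by (simp add: power2_eq_square)
  also have "\<dots> < 0" using \<alpha>(2) \<open>c \<noteq> 0\<close> by simp
  finally have sign: "2 * c * \<alpha> t0 * (m - 1 - m) * (2 * c * \<alpha> t0 * (m + 1 - m)) < 0" .
  have in_I: "\<forall>\<^sub>F t in at t0. \<forall>k\<in>{m - 1..m + 1}. t0 + k * (t - t0) \<in> I"
    by (rule eventually_dilation_in_open[OF I])
  hence "\<forall>\<^sub>F t in at t0. continuous_on {m - 1..m + 1} (H t)"
    unfolding H_def
    by (rule eventually_mono) (intro continuous_intros continuous_on_compose2[OF \<beta>], auto)
  hence "\<forall>\<^sub>F t in at t0. \<exists>k\<in>{m - 1..m + 1}. H t k = 0"
    by (rule eventually_root_between[OF _ _ lim lim sign]) simp
  with in_I show ?thesis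
  proof eventually_elim
    case (elim t)
    then obtain k where k: "k \<in> {m - 1..m + 1}" "H t k = 0" by blast
    define \<tau> where "\<tau> = t0 + k * (t - t0)"
    have "c * (\<alpha> t0 * k\<^sup>2 - \<alpha> t * (1 - k)\<^sup>2) + 2 * \<alpha> t0 * \<alpha> t * \<beta> \<tau> = 0"
      using k(2) by (simp add: H_def \<tau>_def)
    moreover have "(t0 - \<tau>)\<^sup>2 = (t0 - t)\<^sup>2 * k\<^sup>2" "(t - \<tau>)\<^sup>2 = (t0 - t)\<^sup>2 * (1 - k)\<^sup>2"
      by (simp_all add: \<tau>_def power2_eq_square algebra_simps)
    ultimately have "c * (\<alpha> t0 * (t0 - \<tau>)\<^sup>2 - \<alpha> t * (t - \<tau>)\<^sup>2)
        = - 2 * \<alpha> t0 * \<alpha> t * (t0 - t)\<^sup>2 * \<beta> \<tau>"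
      by algebra
    moreover have "\<tau> \<in> I" using elim(1) k(1) by (simp add: \<tau>_def)
    ultimately show ?case by blast
  qed
qed

locale symmetric_bilinear_form =
  fixes B :: "'a::real_vector \<Rightarrow> 'a \<Rightarrow> real"
  assumes bilinear: "bilinear B"
    and symmetric: "B x y = B y x"
begin

lemmas form_simps = bilinear_ladd[OF bilinear] bilinear_radd[OF bilinear]
  bilinear_lsub[OF bilinear] bilinear_rsub[OF bilinear]
  bilinear_lmul[OF bilinear] bilinear_rmul[OF bilinear]
  bilinear_lneg[OF bilinear] bilinear_rneg[OF bilinear]
  bilinear_lzero[OF bilinear] bilinear_rzero[OF bilinear]

lemma form_add: "B (x + y) (x + y) = B x x + 2 * B x y + B y y"
  using symmetric[of x y] by (simp add: form_simps)

lemma form_diff: "B (x - y) (x - y) = B x x - 2 * B x y + B y y"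
  using symmetric[of x y] by (simp add: form_simps)

definition lightlike :: "'a \<Rightarrow> bool" where
  "lightlike v \<longleftrightarrow> B v v = 0"

lemma lightlike_zero [simp]: "lightlike 0"
  by (simp add: lightlike_def form_simps)

lemma lightlike_scaleR [simp]: "lightlike (k *\<^sub>R v) \<longleftrightarrow> k = 0 \<or> lightlike v"
  by (simp add: lightlike_def form_simps)

lemma lightlike_minus [simp]: "lightlike (- v) \<longleftrightarrow> lightlike v"
  by (simp add: lightlike_def form_simps)

lemma lightlike_diff_commute: "lightlike (x - y) \<longleftrightarrow> lightlike (y - x)"
  using lightlike_minus[of "x - y"] by simp

lemma lightlike_diff_iff:
  "lightlike x \<Longrightarrow> lightlike y \<Longrightarrow> lightlike (x - y) \<longleftrightarrow> B x y = 0"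
  by (simp add: lightlike_def form_diff)

text \<open>For lightlike \<open>v\<close>, the equation of the cone of \<open>c\<close> is affine along the line through \<open>x\<close> in
  direction \<open>v\<close>. If \<open>B (x - c) v = 0\<close>, then \<open>cone_hit c x v\<close> is the junk value \<open>x\<close>.\<close>

definition cone_hit :: "'a \<Rightarrow> 'a \<Rightarrow> 'a \<Rightarrow> 'a" where
  "cone_hit c x v = x - (B (x - c) (x - c) / (2 * B (x - c) v)) *\<^sub>R v"

lemma lightlike_cone_hit_diff_iff:
  assumes "lightlike v" "B (x - c) v \<noteq> 0"
  shows "lightlike (cone_hit c x v - y) \<longleftrightarrow>
           B (x - y) (x - y) * B (x - c) v = B (x - c) (x - c) * B (x - y) v"
proof -
  define k where "k = B (x - c) (x - c) / (2 * B (x - c) v)"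
  have "cone_hit c x v - y = (x - y) - k *\<^sub>R v" by (simp add: cone_hit_def k_def)
  hence "B (cone_hit c x v - y) (cone_hit c x v - y) = B (x - y) (x - y) - 2 * (k * B (x - y) v)"
    using assms(1) unfolding lightlike_def
    by (simp only: form_diff[of "x - y"])
       (simp add: bilinear_lmul[OF bilinear] bilinear_rmul[OF bilinear])
  hence "B (cone_hit c x v - y) (cone_hit c x v - y) * B (x - c) v
      = B (x - y) (x - y) * B (x - c) v - B (x - c) (x - c) * B (x - y) v"
    using assms(2) by (simp add: k_def left_diff_distrib)
  thus ?thesis using assms(2) unfolding lightlike_def by (metis mult_eq_0_iff right_minus_eq)
qed

lemma lightlike_cone_hit_diff_vertex:
  "lightlike v \<Longrightarrow> B (x - c) v \<noteq> 0 \<Longrightarrow> lightlike (cone_hit c x v - c)"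
  by (simp add: lightlike_cone_hit_diff_iff)

lemma lightlike_line_diff_cone_hit: "lightlike v \<Longrightarrow> lightlike (x + k *\<^sub>R v - cone_hit c x v)"
  by (simp add: cone_hit_def lightlike_def form_simps)

lemma lightlike_diff_cone_hit: "lightlike v \<Longrightarrow> lightlike (x - cone_hit c x v)"
  using lightlike_line_diff_cone_hit[of v x 0] by simp

lemma cone_hit_on_line: obtains k where "cone_hit c x v = x + k *\<^sub>R v"
  using that[of "- (B (x - c) (x - c) / (2 * B (x - c) v))"] by (simp add: cone_hit_def)

lemma lightlike_cone_hit_diff_cone_hit:
  assumes "lightlike v"
  shows "lightlike (cone_hit c x v - cone_hit c' x v)"
proof -
  obtain k where "cone_hit c x v = x + k *\<^sub>R v" by (rule cone_hit_on_line)
  thus ?thesis using lightlike_line_diff_cone_hit[OF assms] by simp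
qed

lemma lightlike_diff_cone_hit_cone_hit:
  assumes "lightlike v"
  shows "lightlike (x - cone_hit c' (cone_hit c x v) v)"
proof -
  obtain k where "cone_hit c x v = x + k *\<^sub>R v" by (rule cone_hit_on_line)
  thus ?thesis using lightlike_line_diff_cone_hit[OF assms, of "cone_hit c x v" "- k" c'] by simp
qed

lemma form_cone_hit_diff: "lightlike v \<Longrightarrow> B (cone_hit c x v - y) v = B (x - y) v"
  by (simp add: cone_hit_def lightlike_def form_simps)

lemma cone_hit_scaleR: "k \<noteq> 0 \<Longrightarrow> cone_hit c x (k *\<^sub>R v) = cone_hit c x v"
  by (simp add: cone_hit_def form_simps)

text \<open>For an \<open>arc_frame\<close>, \<open>lightlike_arc\<close> is the rational parametrization of an arc of the conic of
  lightlike directions in the three-dimensional subspace spanned by the frame.\<close>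

definition arc_frame :: "'a \<Rightarrow> 'a \<Rightarrow> 'a \<Rightarrow> bool" where
  "arc_frame p e r \<longleftrightarrow> lightlike p \<and> lightlike r \<and> B p r > 0 \<and> B p e = 0 \<and> B r e = 0
     \<and> B e e = - 2 * B p r"

definition lightlike_arc :: "'a \<Rightarrow> 'a \<Rightarrow> 'a \<Rightarrow> real \<Rightarrow> 'a" where
  "lightlike_arc p e r t = (1 - t)\<^sup>2 *\<^sub>R p + (t * (1 - t)) *\<^sub>R e + t\<^sup>2 *\<^sub>R r"

lemma lightlike_arc_ends [simp]: "lightlike_arc p e r 0 = p" "lightlike_arc p e r 1 = r"
  by (simp_all add: lightlike_arc_def)

lemma form_lightlike_arc:
  "B a (lightlike_arc p e r t) = (1 - t)\<^sup>2 * B a p + t * (1 - t) * B a e + t\<^sup>2 * B a r"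
  by (simp add: lightlike_arc_def form_simps)

lemma isCont_form_lightlike_arc: "isCont (\<lambda>t. B a (lightlike_arc p e r t)) t0"
  unfolding form_lightlike_arc by (intro continuous_intros)

lemma eventually_form_lightlike_arc_nonzero:
  "B a (lightlike_arc p e r s) \<noteq> 0 \<Longrightarrow> \<forall>\<^sub>F t in at s. B a (lightlike_arc p e r t) \<noteq> 0"
  using isCont_form_lightlike_arc tendsto_imp_eventually_ne unfolding isCont_def by blast

lemma form_lightlike_arc_lightlike_arc:
  assumes "arc_frame p e r"
  shows "B (lightlike_arc p e r s) (lightlike_arc p e r t) = B p r * (s - t)\<^sup>2"
proof -
  have "B (lightlike_arc p e r s) p = s\<^sup>2 * B p r" "B (lightlike_arc p e r s) r = (1 - s)\<^sup>2 * B p r"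
    "B (lightlike_arc p e r s) e = s * (1 - s) * (- 2 * B p r)"
    using assms
    unfolding symmetric[of "lightlike_arc p e r s"] form_lightlike_arc arc_frame_def lightlike_def
    by (simp_all add: symmetric[of e p] symmetric[of e r] symmetric[of r p])
  hence "B (lightlike_arc p e r s) (lightlike_arc p e r t) = (1 - t)\<^sup>2 * (s\<^sup>2 * B p r)
      + t * (1 - t) * (s * (1 - s) * (- 2 * B p r)) + t\<^sup>2 * ((1 - s)\<^sup>2 * B p r)"
    by (simp only: form_lightlike_arc)
  also have "\<dots> = B p r * (s - t)\<^sup>2" by (simp add: algebra_simps power2_eq_square)
  finally show ?thesis .
qed

lemma lightlike_lightlike_arc: "arc_frame p e r \<Longrightarrow> lightlike (lightlike_arc p e r t)"
  by (simp add: lightlike_def form_lightlike_arc_lightlike_arc)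

lemma lightlike_arc_chord:
  assumes "arc_frame p e r"
  defines "v \<equiv> lightlike_arc p e r"
  shows "B (j *\<^sub>R v s - k *\<^sub>R v t) (j *\<^sub>R v s - k *\<^sub>R v t) = - 2 * j * k * (B p r * (s - t)\<^sup>2)"
    and "B (j *\<^sub>R v s - k *\<^sub>R v t) (v \<tau>) = B p r * (j * (s - \<tau>)\<^sup>2 - k * (t - \<tau>)\<^sup>2)"
  unfolding v_def form_diff
  by (simp_all add: form_simps form_lightlike_arc_lightlike_arc[OF assms(1)] algebra_simps)

lemma finite_lightlike_arc_roots:
  assumes "B a p \<noteq> 0 \<or> B a r \<noteq> 0"
  shows "finite {t. B a (lightlike_arc p e r t) = 0}"
proof -
  define f where "f = [:B a p, B a e - 2 * B a p, B a p - B a e + B a r:]"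
  have "poly f t = B a (lightlike_arc p e r t)" for t
    by (simp add: f_def form_lightlike_arc algebra_simps power2_eq_square)
  moreover have "f \<noteq> 0" using assms by (auto simp: f_def)
  ultimately show ?thesis using poly_roots_finite[of f] by simp
qed

lemma eventually_cone_hits_along_arc_lightlike:
  fixes p e r
  defines "v \<equiv> lightlike_arc p e r"
  assumes frame: "arc_frame p e r"
    and x: "\<not> lightlike (x - a)" "B (x - a) (v t0) \<noteq> 0"
  defines "y \<equiv> cone_hit a x (v t0)"
  assumes y: "\<not> lightlike (y - b)" and I: "open I" "t0 \<in> I" "\<And>\<tau>. \<tau> \<in> I \<Longrightarrow> B (y - b) (v \<tau>) \<noteq> 0"
  shows "\<forall>\<^sub>F t in at t0. \<exists>\<tau>\<in>I. lightlike (cone_hit b y (v \<tau>) - cone_hit a x (v t))"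
proof -
  define \<alpha> where "\<alpha> t = - (B (x - a) (x - a) / (2 * B (x - a) (v t)))" for t
  have cont: "isCont (\<lambda>t. B u (v t)) s" for u s
    unfolding v_def by (rule isCont_form_lightlike_arc)
  have "isCont \<alpha> t0" unfolding \<alpha>_def using x(2) by (intro continuous_intros cont) simp
  moreover have "\<alpha> t0 \<noteq> 0" using x by (simp add: \<alpha>_def lightlike_def)
  moreover have "continuous_on I (\<lambda>\<tau>. B (y - b) (v \<tau>))"
    by (intro continuous_at_imp_continuous_on ballI cont)
  ultimately have "\<forall>\<^sub>F t in at t0. \<exists>\<tau>\<in>I.
      B (y - b) (y - b) * (\<alpha> t0 * (t0 - \<tau>)\<^sup>2 - \<alpha> t * (t - \<tau>)\<^sup>2)
        = - 2 * \<alpha> t0 * \<alpha> t * (t0 - t)\<^sup>2 * B (y - b) (v \<tau>)"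
    using y I(1,2) by (intro eventually_quadratic_balance) (auto simp: lightlike_def)
  thus ?thesis
  proof eventually_elim
    case (elim t)
    then obtain \<tau> where \<tau>: "\<tau> \<in> I" "B (y - b) (y - b) * (\<alpha> t0 * (t0 - \<tau>)\<^sup>2 - \<alpha> t * (t - \<tau>)\<^sup>2)
        = - 2 * \<alpha> t0 * \<alpha> t * (t0 - t)\<^sup>2 * B (y - b) (v \<tau>)" by blast
    define d where "d = y - cone_hit a x (v t)"
    have d: "d = \<alpha> t0 *\<^sub>R v t0 - \<alpha> t *\<^sub>R v t"
      by (simp add: d_def y_def cone_hit_def \<alpha>_def)
    have "B d d = - 2 * \<alpha> t0 * \<alpha> t * (B p r * (t0 - t)\<^sup>2)"
      and "B d (v \<tau>) = B p r * (\<alpha> t0 * (t0 - \<tau>)\<^sup>2 - \<alpha> t * (t - \<tau>)\<^sup>2)"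
      unfolding d v_def by (rule lightlike_arc_chord[OF frame])+
    hence "B d d * B (y - b) (v \<tau>) = B (y - b) (y - b) * B d (v \<tau>)"
      using \<tau>(2) by algebra
    moreover have "lightlike (v \<tau>)" unfolding v_def by (rule lightlike_lightlike_arc[OF frame])
    ultimately show ?case
      using \<tau>(1) I(3) lightlike_cone_hit_diff_iff[of "v \<tau>" y b "cone_hit a x (v t)"]
      by (auto simp: d_def)
  qed
qed

end

locale lorentz_form = symmetric_bilinear_form B
  for B :: "'a::euclidean_space \<Rightarrow> 'a \<Rightarrow> real" +
  fixes e0 :: 'a
  assumes unit_timelike: "B e0 e0 = 1"
    and negative_orthogonal: "B e0 x = 0 \<Longrightarrow> x \<noteq> 0 \<Longrightarrow> B x x < 0"
begin

lemma continuous_on_form [continuous_intros]: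
  "continuous_on S f \<Longrightarrow> continuous_on S g \<Longrightarrow> continuous_on S (\<lambda>t. B (f t) (g t))"
  using bilinear bilinear_conv_bounded_bilinear bounded_bilinear.continuous_on by blast

lemma continuous_on_cone_hit [continuous_intros]:
  assumes "continuous_on S f" "continuous_on S g" "\<And>t. t \<in> S \<Longrightarrow> B (f t - c) (g t) \<noteq> 0"
  shows "continuous_on S (\<lambda>t. cone_hit c (f t) (g t))"
  unfolding cone_hit_def using assms by (intro continuous_intros) auto

lemma continuous_on_lightlike_arc [continuous_intros]: "continuous_on S (lightlike_arc p e r)"
  unfolding lightlike_arc_def by (intro continuous_intros)

lemma open_form_nonzero: "open {u. B a u \<noteq> 0}"
  by (intro open_Collect_neq continuous_intros)

lemma orthogonal_vector_exists:
  assumes "finite A" "card A < DIM('a)"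
  obtains e where "e \<noteq> 0" "\<And>a. a \<in> A \<Longrightarrow> B a e = 0"
proof -
  have linear: "linear (B a)" for a using bilinear by (simp add: bilinear_def)
  define dual where "dual a = adjoint (B a) 1" for a
  have dual: "x \<bullet> dual a = B a x" for a x
    using adjoint_works[OF linear, of x a 1] by (simp add: dual_def)
  have "dim (dual ` A) \<le> card (dual ` A)"
    using assms(1) by (intro dim_le_card) (auto intro: span_base)
  also have "\<dots> < DIM('a)" using card_image_le[OF assms(1), of dual] assms(2) by simp
  finally obtain e where e: "e \<noteq> 0" "\<And>y. y \<in> span (dual ` A) \<Longrightarrow> orthogonal e y"
    by (rule orthogonal_to_subspace_exists) blast
  have "B a e = 0" if "a \<in> A" for a
    using e(2)[of "dual a"] that by (simp add: orthogonal_def dual span_base)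
  with e(1) show ?thesis by (rule that)
qed

lemma nonpos_orthogonal: "B e0 x = 0 \<Longrightarrow> B x x \<le> 0"
  using negative_orthogonal[of x] by (cases "x = 0") (auto simp: form_simps)

lemma lightlike_orthogonal_parallel:
  assumes "lightlike x" "lightlike y" "B x y = 0" "x \<noteq> 0"
  obtains k where "y = k *\<^sub>R x"
proof -
  define z where "z = B e0 y *\<^sub>R x - B e0 x *\<^sub>R y"
  have "B e0 z = 0" by (simp add: z_def form_simps)
  moreover have "B z z = 0"
    using assms(1-3) unfolding z_def form_diff lightlike_def by (simp add: form_simps)
  ultimately have "z = 0" using negative_orthogonal by fastforce
  hence "B e0 x *\<^sub>R y = B e0 y *\<^sub>R x" by (simp add: z_def)
  moreover have "B e0 x \<noteq> 0"
    using negative_orthogonal assms(1,4) unfolding lightlike_def by fastforce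
  ultimately have "y = (B e0 y / B e0 x) *\<^sub>R x"
    by (simp add: eq_vector_fraction_iff)
  thus ?thesis by (rule that)
qed

lemma timelike_orthogonal_negative:
  assumes u: "B u u > 0" and "B u x = 0" "x \<noteq> 0"
  shows "B x x < 0"
proof (cases "B e0 x = 0")
  case False
  define y where "y = B e0 u *\<^sub>R x - B e0 x *\<^sub>R u"
  have "B e0 y = 0" by (simp add: y_def form_simps)
  hence "B y y \<le> 0" by (rule nonpos_orthogonal)
  moreover have "B y y = (B e0 u)\<^sup>2 * B x x + (B e0 x)\<^sup>2 * B u u"
    using assms(2) symmetric[of u x] unfolding y_def form_diff
    by (simp add: form_simps power2_eq_square)
  moreover have "(B e0 x)\<^sup>2 * B u u > 0" using False u by simp
  ultimately have "(B e0 u)\<^sup>2 * B x x < 0" by linarith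
  thus ?thesis by (simp add: mult_less_0_iff)
qed (use negative_orthogonal assms in auto)

lemma lightlike_diff_via_common_line:
  assumes "c \<noteq> z" "lightlike (z - c)"
    and y: "lightlike (y - c)" "lightlike (z - y)" and y': "lightlike (y' - c)" "lightlike (z - y')"
  shows "lightlike (y - y')"
proof -
  have on_line: "\<exists>k. u - c = k *\<^sub>R (z - c)" if "lightlike (u - c)" "lightlike (z - u)" for u
  proof -
    have "lightlike ((z - c) - (u - c))" using that(2) by simp
    hence "B (z - c) (u - c) = 0" using assms(2) that(1) lightlike_diff_iff by blast
    thus ?thesis using lightlike_orthogonal_parallel assms(1,2) that(1) by (metis right_minus_eq)
  qed
  obtain j k where "y - c = j *\<^sub>R (z - c)" "y' - c = k *\<^sub>R (z - c)"
    using on_line y y' by blast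
  hence "y - y' = (j - k) *\<^sub>R (z - c)"
    unfolding scaleR_left_diff_distrib by (metis diff_diff_eq2 diff_add_cancel)
  thus ?thesis using assms(2) by simp
qed

lemma lightlike_line_meets_cone_once:
  assumes x: "\<not> lightlike (x - c)"
    and y: "lightlike (y - c)" "lightlike (x - y)" and y': "lightlike (y' - c)" "lightlike (x - y')"
    and "lightlike (y - y')"
  shows "y = y'"
proof (rule ccontr)
  assume "y \<noteq> y'"
  hence "lightlike (x - c)"
    using assms(6) y y' lightlike_diff_commute
    by (intro lightlike_diff_via_common_line[of y y' x c]) blast+
  thus False using x by contradiction
qed

lemma lightlike_same_side:
  assumes "lightlike p" "lightlike r" "B p r > 0" "lightlike c"
  shows "B c p * B c r \<ge> 0"
proof (rule ccontr)
  assume "\<not> B c p * B c r \<ge> 0"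
  hence neg: "B c p * B c r < 0" by simp
  define u where "u = B c r *\<^sub>R p - B c p *\<^sub>R r"
  have "B u u = - 2 * (B c p * B c r) * B p r"
    using assms(1,2) unfolding u_def form_diff lightlike_def by (simp add: form_simps)
  also have "\<dots> > 0" using neg assms(3) by (simp add: mult_neg_pos)
  finally have "B u u > 0" .
  moreover have "B u c = 0" by (simp add: u_def form_simps symmetric[of _ c])
  moreover have "c \<noteq> 0" using neg by (auto simp: form_simps)
  ultimately show False
    using timelike_orthogonal_negative assms(4) unfolding lightlike_def by fastforce
qed

lemma lightlike_not_orthogonal_exists:
  assumes "1 < DIM('a)" "a \<noteq> 0"
  obtains r where "lightlike r" "B a r \<noteq> 0"
proof -
  obtain x where x: "B e0 x = 0" "x \<noteq> 0" "B a e0 \<noteq> 0 \<or> B a x \<noteq> 0"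
  proof (cases "B a e0 = 0")
    case True
    hence "B e0 a = 0" using symmetric by metis
    thus ?thesis using that[of a] negative_orthogonal[of a] assms(2) by simp
  next
    case False
    thus ?thesis using orthogonal_vector_exists[of "{e0}"] that assms(1) by auto
  qed
  define s where "s = sqrt (- B x x)"
  have s: "s > 0" "s * s = - B x x" using negative_orthogonal[OF x(1,2)] by (auto simp: s_def)
  have "lightlike (s *\<^sub>R e0 + x)" "lightlike (s *\<^sub>R e0 - x)"
    using x(1) s(2) unit_timelike unfolding lightlike_def form_add form_diff
    by (simp_all add: form_simps)
  moreover have "B a (s *\<^sub>R e0 + x) \<noteq> 0 \<or> B a (s *\<^sub>R e0 - x) \<noteq> 0"
    using x(3) s(1) by (auto simp: form_simps)
  ultimately show ?thesis using that by blast
qed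

lemma arc_frame_exists:
  assumes "2 < DIM('a)" "lightlike p" "lightlike r" "B p r > 0"
  obtains e where "arc_frame p e r"
proof -
  have "finite {p, r}" "card {p, r} < DIM('a)" using assms(1) by (simp_all add: card_insert_if)
  then obtain e where "e \<noteq> 0" "\<And>a. a \<in> {p, r} \<Longrightarrow> B a e = 0"
    by (rule orthogonal_vector_exists) blast
  hence e: "e \<noteq> 0" "B p e = 0" "B r e = 0" by simp_all
  have "B (p + r) (p + r) > 0" using assms(2-4) by (simp add: form_add lightlike_def)
  moreover have "B (p + r) e = 0" using e by (simp add: form_simps)
  ultimately have neg: "B e e < 0" using timelike_orthogonal_negative e(1) by blast
  define k where "k = sqrt (2 * B p r / - B e e)"
  have "k * k = 2 * B p r / - B e e" using neg assms(4) by (simp add: k_def divide_nonneg_neg)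
  hence "k * (k * B e e) = - 2 * B p r" using neg by (simp add: field_simps)
  hence "arc_frame p (k *\<^sub>R e) r" using assms e by (simp add: arc_frame_def form_simps)
  thus ?thesis by (rule that)
qed

lemma arc_frame_minus: "arc_frame p e r \<Longrightarrow> arc_frame p (- e) r"
  by (simp add: arc_frame_def form_simps)

lemma lightlike_arc_avoiding_exists:
  assumes "2 < DIM('a)" and pr: "lightlike p" "lightlike r" "B p r > 0"
    and c: "lightlike c" "B c p \<noteq> 0" "B c r \<noteq> 0"
  obtains e where "arc_frame p e r" "\<And>t. t \<in> {0..1} \<Longrightarrow> B c (lightlike_arc p e r t) \<noteq> 0"
proof -
  obtain d where d: "arc_frame p d r" using arc_frame_exists assms(1) pr by blast
  define e where "e = (if 0 \<le> B c r * B c d then d else - d)"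
  have e: "arc_frame p e r" "0 \<le> B c r * B c e"
    using d arc_frame_minus by (auto simp: e_def form_simps)
  have "B c p * B c r \<ge> 0" using pr c(1) by (rule lightlike_same_side)
  hence side: "B c r * B c p > 0" using c(2,3) by (simp add: less_le mult.commute)
  have "B c (lightlike_arc p e r t) \<noteq> 0" if t: "t \<in> {0..1}" for t
  proof -
    have "0 < (1 - t)\<^sup>2 * (B c r * B c p) + t\<^sup>2 * (B c r)\<^sup>2"
      using side c(3) by (cases "t = 0") (simp_all add: add_nonneg_pos)
    moreover have "0 \<le> t * (1 - t) * (B c r * B c e)" using t e(2) by simp
    moreover have "B c r * B c (lightlike_arc p e r t)
        = (1 - t)\<^sup>2 * (B c r * B c p) + t\<^sup>2 * (B c r)\<^sup>2 + t * (1 - t) * (B c r * B c e)"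
      by (simp add: form_lightlike_arc algebra_simps power2_eq_square)
    ultimately have "B c r * B c (lightlike_arc p e r t) > 0" by linarith
    thus ?thesis by auto
  qed
  thus ?thesis using that e(1) by blast
qed

lemma lightlike_curve_transverse_exists:
  assumes dim: "2 < DIM('a)" and v: "lightlike v" "B a v = 0" and "a \<noteq> 0"
  obtains f :: "real \<Rightarrow> 'a" where "isCont f 0" "f 0 = v" "\<And>t. lightlike (f t)"
    "finite {t. B a (f t) = 0}"
proof -
  have "1 < DIM('a)" using dim by simp
  then obtain r where r: "lightlike r" "B a r \<noteq> 0"
    using lightlike_not_orthogonal_exists \<open>a \<noteq> 0\<close> by blast
  show ?thesis
  proof (cases "v = 0")
    case True
    show ?thesis
    proof (rule that[of "\<lambda>t. t *\<^sub>R r"])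
      show "finite {t. B a (t *\<^sub>R r) = 0}" using r(2) by (simp add: form_simps)
    qed (use True r in \<open>auto intro!: continuous_intros\<close>)
  next
    case False
    have "B v r \<noteq> 0"
    proof
      assume "B v r = 0"
      then obtain k where "r = k *\<^sub>R v"
        using lightlike_orthogonal_parallel v(1) r(1) False by blast
      thus False using v(2) r(2) by (simp add: form_simps)
    qed
    define r' where "r' = sgn (B v r) *\<^sub>R r"
    have r': "lightlike r'" "B a r' \<noteq> 0" "B v r' > 0"
      using r \<open>B v r \<noteq> 0\<close> by (auto simp: r'_def form_simps sgn_if)
    obtain e where e: "arc_frame v e r'" using arc_frame_exists dim v(1) r'(1,3) by blast
    show ?thesis
    proof (rule that[of "lightlike_arc v e r'"])
      show "isCont (lightlike_arc v e r') 0"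
        using continuous_on_lightlike_arc[of UNIV] by (simp add: continuous_on_eq_continuous_at)
    qed (use e r' in \<open>auto intro: lightlike_lightlike_arc finite_lightlike_arc_roots\<close>)
  qed
qed

lemma lightlike_dense_off_hyperplane:
  assumes "2 < DIM('a)" "open U" "v \<in> U" "lightlike v" "a \<noteq> 0"
  obtains w where "w \<in> U" "lightlike w" "B a w \<noteq> 0"
proof (cases "B a v = 0")
  case True
  then obtain f :: "real \<Rightarrow> 'a" where f: "isCont f 0" "f 0 = v" "\<And>t. lightlike (f t)"
    "finite {t. B a (f t) = 0}"
    using lightlike_curve_transverse_exists assms(1,4,5) by blast
  have "(f \<longlongrightarrow> v) (at 0)" using f(1,2) by (simp add: isCont_def)
  hence "\<forall>\<^sub>F t in at 0. f t \<in> U" using assms(2,3) by (rule topological_tendstoD)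
  moreover have "\<forall>\<^sub>F t in at 0. t \<notin> {t. B a (f t) = 0}"
    by (rule eventually_at_not_in_finite[OF f(4)])
  ultimately have "\<forall>\<^sub>F t in at 0. f t \<in> U \<and> B a (f t) \<noteq> 0" by eventually_elim simp
  then obtain t where "f t \<in> U" "B a (f t) \<noteq> 0" using eventually_happens' at_neq_bot by blast
  thus ?thesis using that f(3) by blast
qed (use assms that in blast)

lemma lightlike_dense_off_hyperplanes:
  assumes "finite A" "0 \<notin> A" and "2 < DIM('a)" "open U" "v \<in> U" "lightlike v"
  obtains w where "w \<in> U" "lightlike w" "\<And>a. a \<in> A \<Longrightarrow> B a w \<noteq> 0"
proof -
  have "\<exists>w\<in>U. lightlike w \<and> (\<forall>a\<in>A. B a w \<noteq> 0)"
    using assms(1,2,4-6)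
  proof (induction A arbitrary: U v rule: finite_induct)
    case (insert a A)
    obtain u where u: "u \<in> U" "lightlike u" "B a u \<noteq> 0"
      using lightlike_dense_off_hyperplane assms(3) insert.prems by (metis insertI1)
    have "\<exists>w\<in>U \<inter> {u. B a u \<noteq> 0}. lightlike w \<and> (\<forall>a\<in>A. B a w \<noteq> 0)"
      using insert.prems u open_form_nonzero by (intro insert.IH[of _ u]) auto
    thus ?case by auto
  qed auto
  thus ?thesis using that by blast
qed

end

locale collapsing_preserver = lorentz_form B e0
  for B :: "'a::euclidean_space \<Rightarrow> 'a \<Rightarrow> real" and e0 +
  fixes \<phi> :: "'a \<Rightarrow> 'a" and a b :: 'a
  assumes dim: "2 < DIM('a)"
    and continuous_phi: "continuous_on UNIV \<phi>"
    and preserver: "coherency_preserver (\<lambda>x. B x x) \<phi>"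
    and adjacent: "adjacent (\<lambda>x. B x x) a b"
    and collapse: "\<phi> b = \<phi> a"
begin

lemma lightlike_phi: "lightlike (x - y) \<Longrightarrow> lightlike (\<phi> x - \<phi> y)"
  using preserver by (simp add: coherency_preserver_def coherent_def lightlike_def)

lemma lightlike_phi_b: "lightlike (x - b) \<Longrightarrow> lightlike (\<phi> x - \<phi> a)"
  using lightlike_phi[of x b] collapse by simp

lemma continuous_on_phi [continuous_intros]:
  "continuous_on S f \<Longrightarrow> continuous_on S (\<lambda>t. \<phi> (f t))"
  using continuous_on_compose2[OF continuous_phi] by blast

lemma a_neq_b: "a \<noteq> b" and lightlike_b_diff_a: "lightlike (b - a)"
  using adjacent lightlike_diff_commute[of a b]
  by (auto simp: adjacent_def coherent_def lightlike_def)

lemma form_diff_b: "B (x - b) v = B (x - a) v - B (b - a) v"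
  by (simp add: form_simps)

lemma phi_cone_hit_eq:
  assumes x: "\<not> lightlike (\<phi> x - \<phi> a)" and v: "lightlike v" "B (x - a) v \<noteq> 0" "B (x - b) v \<noteq> 0"
  shows "\<phi> (cone_hit a x v) = \<phi> (cone_hit b x v)"
proof (rule lightlike_line_meets_cone_once[OF x])
  show "lightlike (\<phi> (cone_hit a x v) - \<phi> a)"
    using v by (intro lightlike_phi lightlike_cone_hit_diff_vertex)
  show "lightlike (\<phi> (cone_hit b x v) - \<phi> a)"
    using v by (intro lightlike_phi_b lightlike_cone_hit_diff_vertex)
qed (use v in \<open>auto intro: lightlike_phi lightlike_diff_cone_hit lightlike_cone_hit_diff_cone_hit\<close>)

lemma phi_eq_via_common_point:
  assumes x: "\<not> lightlike (\<phi> x - \<phi> a)"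
    and y: "lightlike (y - a)" "lightlike (x - y)" and y': "lightlike (y' - a)" "lightlike (x - y')"
    and z: "lightlike (z - b)" "lightlike (z - y)" "lightlike (z - y')" "\<phi> z \<noteq> \<phi> a"
  shows "\<phi> y = \<phi> y'"
proof (rule lightlike_line_meets_cone_once[OF x])
  show "lightlike (\<phi> y - \<phi> y')"
  proof (rule lightlike_diff_via_common_line[of "\<phi> a" "\<phi> z"])
    show "\<phi> a \<noteq> \<phi> z" using z(4) by simp
    show "lightlike (\<phi> z - \<phi> a)" by (rule lightlike_phi_b[OF z(1)])
  qed (intro lightlike_phi y y' z)+
qed (intro lightlike_phi y y')+

lemma phi_cone_hit_eq_via_second_cone:
  assumes x: "\<not> lightlike (\<phi> x - \<phi> a)"
    and v: "lightlike v" "B (x - a) v \<noteq> 0" and v': "lightlike v'" "B (x - a) v' \<noteq> 0"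
  defines "y \<equiv> cone_hit a x v" and "y' \<equiv> cone_hit a x v'"
  assumes u: "lightlike u" "B (y - b) u \<noteq> 0" "\<phi> (cone_hit b y u) \<noteq> \<phi> a"
    and "lightlike (cone_hit b y u - y')"
  shows "\<phi> y = \<phi> y'"
proof (rule phi_eq_via_common_point[OF x])
  show "lightlike (y - a)" "lightlike (y' - a)"
    unfolding y_def y'_def by (intro lightlike_cone_hit_diff_vertex v v')+
  show "lightlike (x - y)" "lightlike (x - y')"
    unfolding y_def y'_def by (intro lightlike_diff_cone_hit v v')+
  show "lightlike (cone_hit b y u - b)" by (intro lightlike_cone_hit_diff_vertex u)
  show "lightlike (cone_hit b y u - y)"
    using lightlike_diff_cone_hit[OF u(1)] lightlike_diff_commute by blast
qed fact+

definition generic_direction :: "'a \<Rightarrow> 'a \<Rightarrow> bool" where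
  "generic_direction x v \<longleftrightarrow> lightlike v \<and> B (x - a) v \<noteq> 0 \<and> B (x - b) v \<noteq> 0 \<and> B (b - a) v \<noteq> 0
     \<and> \<not> lightlike (cone_hit a x v - b)"

text \<open>The last vector expresses \<open>lightlike (cone_hit a x v - b)\<close> as a condition linear in \<open>v\<close>.\<close>

definition direction_obstructions :: "'a \<Rightarrow> 'a set" where
  "direction_obstructions x = {x - a, x - b, b - a,
     B (x - b) (x - b) *\<^sub>R (x - a) - B (x - a) (x - a) *\<^sub>R (x - b)}"

lemma generic_direction_iff:
  "generic_direction x v \<longleftrightarrow> lightlike v \<and> (\<forall>u\<in>direction_obstructions x. B u v \<noteq> 0)"
  using lightlike_cone_hit_diff_iff[of v x a b]
  by (auto simp: generic_direction_def direction_obstructions_def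
      bilinear_lsub[OF bilinear, of "_ *\<^sub>R _"] bilinear_lmul[OF bilinear])

lemma finite_direction_obstructions: "finite (direction_obstructions x)"
  by (simp add: direction_obstructions_def)

lemma generic_direction_scaleR:
  "generic_direction x v \<Longrightarrow> k \<noteq> 0 \<Longrightarrow> generic_direction x (k *\<^sub>R v)"
  by (auto simp: generic_direction_iff bilinear_rmul[OF bilinear])

lemma zero_notin_direction_obstructions:
  assumes "\<not> lightlike (\<phi> x - \<phi> a)"
  shows "0 \<notin> direction_obstructions x"
proof -
  have xa: "\<not> lightlike (x - a)" and xb: "\<not> lightlike (x - b)"
    using assms lightlike_phi lightlike_phi_b by blast+
  have "B (x - b) (x - b) *\<^sub>R (x - a) \<noteq> B (x - a) (x - a) *\<^sub>R (x - b)"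
  proof
    define k where "k = B (x - b) (x - b) / B (x - a) (x - a)"
    assume "B (x - b) (x - b) *\<^sub>R (x - a) = B (x - a) (x - a) *\<^sub>R (x - b)"
    hence k: "x - b = k *\<^sub>R (x - a)"
      using xa by (simp add: k_def eq_vector_fraction_iff lightlike_def)
    hence "B (x - b) (x - b) = k * (k * B (x - a) (x - a))"
      by (simp only: bilinear_lmul[OF bilinear] bilinear_rmul[OF bilinear] real_scaleR_def)
    moreover have "B (x - b) (x - b) = k * B (x - a) (x - a)"
      using xa by (simp add: k_def lightlike_def)
    ultimately have "k = 1" using xb by (auto simp: lightlike_def)
    thus False using k a_neq_b by simp
  qed
  moreover have "x - a \<noteq> 0" "x - b \<noteq> 0" using xa xb by (metis lightlike_zero)+
  ultimately show ?thesis using a_neq_b by (auto simp: direction_obstructions_def)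
qed

lemma generic_direction_dense:
  assumes "\<not> lightlike (\<phi> x - \<phi> a)" "open U" "v \<in> U" "lightlike v"
  obtains p where "p \<in> U" "generic_direction x p"
proof -
  obtain p where "p \<in> U" "lightlike p" "\<And>u. u \<in> direction_obstructions x \<Longrightarrow> B u p \<noteq> 0"
    using lightlike_dense_off_hyperplanes[OF finite_direction_obstructions
        zero_notin_direction_obstructions[OF assms(1)] dim assms(2-4)] by blast
  thus ?thesis using that generic_direction_iff by blast
qed

lemma finite_not_generic_lightlike_arc:
  assumes "arc_frame p e r" "generic_direction x p"
  shows "finite {t. \<not> generic_direction x (lightlike_arc p e r t)}"
proof (rule finite_subset)
  show "{t. \<not> generic_direction x (lightlike_arc p e r t)}
      \<subseteq> (\<Union>u\<in>direction_obstructions x. {t. B u (lightlike_arc p e r t) = 0})"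
    using lightlike_lightlike_arc[OF assms(1)] by (auto simp: generic_direction_iff)
  show "finite (\<Union>u\<in>direction_obstructions x. {t. B u (lightlike_arc p e r t) = 0})"
    using assms(2) finite_direction_obstructions
    by (auto simp: generic_direction_iff intro!: finite_lightlike_arc_roots)
qed

lemma phi_cone_hit_lightlike_arc_eventually_const:
  fixes p e r
  defines "v \<equiv> lightlike_arc p e r"
  assumes frame: "arc_frame p e r" and x: "\<not> lightlike (\<phi> x - \<phi> a)"
    and generic: "generic_direction x (v t0)"
  shows "\<forall>\<^sub>F t in at t0. \<phi> (cone_hit a x (v t)) = \<phi> (cone_hit a x (v t0))"
proof -
  have v: "lightlike (v t)" for t unfolding v_def by (rule lightlike_lightlike_arc[OF frame])
  have cont_v: "continuous_on S v" for S unfolding v_def by (rule continuous_on_lightlike_arc)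
  have xa: "B (x - a) (v t0) \<noteq> 0" using generic by (simp add: generic_direction_def)
  define y where "y = cone_hit a x (v t0)"
  define J where "J = {\<tau>. B (y - b) (v \<tau>) \<noteq> 0}"
  define I where "I = J \<inter> (\<lambda>\<tau>. \<phi> (cone_hit b y (v \<tau>))) -` (- {\<phi> a})"
  have "open J" unfolding J_def by (intro open_Collect_neq continuous_intros cont_v)
  moreover have "continuous_on J (\<lambda>\<tau>. \<phi> (cone_hit b y (v \<tau>)))"
    unfolding J_def by (intro continuous_intros cont_v) simp
  ultimately have "open I" unfolding I_def by (intro continuous_open_preimage) auto
  have "t0 \<in> J"
    using generic form_cone_hit_diff[OF v] by (simp add: J_def y_def generic_direction_def)
  moreover have "\<phi> (cone_hit b y (v t0)) \<noteq> \<phi> a"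
    using lightlike_phi[OF lightlike_diff_cone_hit_cone_hit[OF v]] x unfolding y_def by metis
  ultimately have "t0 \<in> I" by (simp add: I_def)
  have "\<not> lightlike (x - a)" using x lightlike_phi by blast
  hence "\<forall>\<^sub>F t in at t0. \<exists>\<tau>\<in>I. lightlike (cone_hit b y (v \<tau>) - cone_hit a x (v t))"
    unfolding y_def v_def using generic \<open>open I\<close> \<open>t0 \<in> I\<close>
    by (intro eventually_cone_hits_along_arc_lightlike[OF frame])
       (auto simp: generic_direction_def I_def J_def v_def y_def)
  moreover have "\<forall>\<^sub>F t in at t0. B (x - a) (v t) \<noteq> 0"
    using xa unfolding v_def by (rule eventually_form_lightlike_arc_nonzero)
  ultimately show ?thesis
  proof eventually_elim
    case (elim t)
    then obtain \<tau> where "B (y - b) (v \<tau>) \<noteq> 0" "\<phi> (cone_hit b y (v \<tau>)) \<noteq> \<phi> a"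
      "lightlike (cone_hit b y (v \<tau>) - cone_hit a x (v t))"
      by (auto simp: I_def J_def)
    thus ?case
      using phi_cone_hit_eq_via_second_cone[OF x v xa v elim(2) v] unfolding y_def by metis
  qed
qed

text \<open>The two branches agree where both cones are met, so this is the common value of \<open>\<phi>\<close> at the
  intersections of the line through \<open>x\<close> in direction \<open>v\<close> with the cones of \<open>a\<close> and \<open>b\<close>, continued to
  directions in which the line misses one of them.\<close>

definition hit_value :: "'a \<Rightarrow> 'a \<Rightarrow> 'a" where
  "hit_value x v = (if B (x - a) v \<noteq> 0 then \<phi> (cone_hit a x v) else \<phi> (cone_hit b x v))"

lemma hit_value_scaleR: "k \<noteq> 0 \<Longrightarrow> hit_value x (k *\<^sub>R v) = hit_value x v"
  by (simp add: hit_value_def cone_hit_scaleR bilinear_rmul[OF bilinear])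

lemma continuous_on_hit_value:
  assumes "\<not> lightlike (\<phi> x - \<phi> a)"
  shows "continuous_on {v. lightlike v \<and> B (b - a) v \<noteq> 0} (hit_value x)"
proof -
  define L where "L = {v. lightlike v \<and> B (b - a) v \<noteq> 0}"
  define S T where "S = L \<inter> {v. B (x - a) v \<noteq> 0}" and "T = L \<inter> {v. B (x - b) v \<noteq> 0}"
  have "continuous_on S (\<lambda>v. \<phi> (cone_hit a x v))"
    unfolding S_def by (intro continuous_intros) simp
  hence "continuous_on S (hit_value x)"
    by (rule continuous_on_eq) (simp add: S_def hit_value_def)
  moreover have "continuous_on T (\<lambda>v. \<phi> (cone_hit b x v))"
    unfolding T_def by (intro continuous_intros) simp
  hence "continuous_on T (hit_value x)"
    by (rule continuous_on_eq) (auto simp: T_def L_def hit_value_def phi_cone_hit_eq[OF assms])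
  moreover have "S \<union> T = L" by (auto simp: S_def T_def L_def form_diff_b)
  moreover have "openin (top_of_set L) S" "openin (top_of_set L) T"
    unfolding S_def T_def by (intro openin_open_Int open_form_nonzero)+
  ultimately have "continuous_on L (hit_value x)"
    using continuous_on_Un_local_open[of S T "hit_value x"] by simp
  thus ?thesis by (simp add: L_def)
qed

lemma hit_value_lightlike_arc_eventually_const:
  assumes "arc_frame p e r" "\<not> lightlike (\<phi> x - \<phi> a)" "generic_direction x (lightlike_arc p e r s)"
  shows "\<forall>\<^sub>F t in at s. hit_value x (lightlike_arc p e r t) = hit_value x (lightlike_arc p e r s)"
proof -
  have "\<forall>\<^sub>F t in at s. B (x - a) (lightlike_arc p e r t) \<noteq> 0"
    using assms(3) eventually_form_lightlike_arc_nonzero by (simp add: generic_direction_def)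
  with phi_cone_hit_lightlike_arc_eventually_const[OF assms] show ?thesis
    by eventually_elim (use assms(3) in \<open>simp add: hit_value_def generic_direction_def\<close>)
qed

lemma hit_value_eq_of_form_pos:
  assumes x: "\<not> lightlike (\<phi> x - \<phi> a)"
    and p: "generic_direction x p" and r: "generic_direction x r" and "B p r > 0"
  shows "hit_value x p = hit_value x r"
proof -
  obtain e where frame: "arc_frame p e r"
    and avoid: "\<And>t. t \<in> {0..1} \<Longrightarrow> B (b - a) (lightlike_arc p e r t) \<noteq> 0"
    using lightlike_arc_avoiding_exists[OF dim _ _ \<open>B p r > 0\<close> lightlike_b_diff_a] p r
    unfolding generic_direction_def by metis
  have "continuous_on {0..1} (\<lambda>t. hit_value x (lightlike_arc p e r t))"
    using avoid lightlike_lightlike_arc[OF frame]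
    by (intro continuous_on_compose2[OF continuous_on_hit_value[OF x]] continuous_intros) auto
  hence "hit_value x (lightlike_arc p e r 1) = hit_value x (lightlike_arc p e r 0)"
    using finite_not_generic_lightlike_arc[OF frame p]
    by (intro eventually_constant_imp_eq_endpoints[of 0 1])
       (auto intro: hit_value_lightlike_arc_eventually_const[OF frame x])
  thus ?thesis by simp
qed

lemma phi_cone_hit_constant:
  assumes x: "\<not> lightlike (\<phi> x - \<phi> a)" and p: "generic_direction x p" and r: "generic_direction x r"
  shows "\<phi> (cone_hit a x p) = \<phi> (cone_hit a x r)"
proof (cases "B p r = 0")
  case True
  have "p \<noteq> 0" "r \<noteq> 0" using p r by (auto simp: generic_direction_def form_simps)
  moreover obtain k where "r = k *\<^sub>R p"
    using lightlike_orthogonal_parallel True p r \<open>p \<noteq> 0\<close> unfolding generic_direction_def by metis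
  ultimately show ?thesis using cone_hit_scaleR by auto
next
  case False
  define k where "k = sgn (B p r)"
  have "k \<noteq> 0" using False by (simp add: k_def sgn_eq_0_iff)
  have "B p (k *\<^sub>R r) = \<bar>B p r\<bar>" by (simp add: k_def form_simps abs_sgn mult.commute)
  hence "B p (k *\<^sub>R r) > 0" using False by simp
  hence "hit_value x p = hit_value x (k *\<^sub>R r)"
    using hit_value_eq_of_form_pos x p generic_direction_scaleR[OF r \<open>k \<noteq> 0\<close>] by blast
  thus ?thesis
    using hit_value_scaleR[OF \<open>k \<noteq> 0\<close>] p r by (simp add: hit_value_def generic_direction_def)
qed

definition cone_focus :: "'a \<Rightarrow> 'a \<Rightarrow> bool" where
  "cone_focus x w \<longleftrightarrow> (\<forall>z. lightlike (x - z) \<longrightarrow>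
     lightlike (\<phi> z - w) \<and> (lightlike (\<phi> z - \<phi> a) \<longrightarrow> \<phi> z = w))"

lemma cone_focus_exists:
  assumes x: "\<not> lightlike (\<phi> x - \<phi> a)"
  obtains w where "cone_focus x w"
proof -
  obtain p where p: "generic_direction x p"
    using generic_direction_dense[OF x open_UNIV, of 0] by auto
  define w where "w = \<phi> (cone_hit a x p)"
  have wa: "lightlike (w - \<phi> a)"
    using p unfolding w_def generic_direction_def
    by (intro lightlike_phi lightlike_cone_hit_diff_vertex) auto
  have coherent: "lightlike (\<phi> z - w)" if "lightlike (x - z)" for z
  proof (rule ccontr)
    assume "\<not> lightlike (\<phi> z - w)"
    define U where "U = {u. B (\<phi> (x + u) - w) (\<phi> (x + u) - w) \<noteq> 0}"
    have "open U" unfolding U_def by (intro open_Collect_neq continuous_intros)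
    moreover have "z - x \<in> U" using \<open>\<not> lightlike (\<phi> z - w)\<close> by (simp add: U_def lightlike_def)
    moreover have "lightlike (z - x)" using that lightlike_diff_commute by blast
    ultimately obtain v where v: "v \<in> U" "generic_direction x v"
      using generic_direction_dense[OF x] by blast
    have "w = \<phi> (cone_hit a x v)" unfolding w_def by (rule phi_cone_hit_constant[OF x p v(2)])
    moreover have "lightlike (x + v - cone_hit a x v)"
      using lightlike_line_diff_cone_hit[of v x 1] v(2) by (simp add: generic_direction_def)
    ultimately have "lightlike (\<phi> (x + v) - w)" using lightlike_phi by blast
    thus False using v(1) by (simp add: U_def lightlike_def)
  qed
  moreover have "\<phi> z = w" if "lightlike (x - z)" "lightlike (\<phi> z - \<phi> a)" for z
    using lightlike_line_meets_cone_once[OF x that(2) lightlike_phi[OF that(1)] wa] coherent that(1)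
    by simp
  ultimately show ?thesis using that unfolding cone_focus_def by blast
qed

lemma cone_focus_lightlike:
  assumes w: "cone_focus x w" and r: "lightlike r" "B (x - a) r \<noteq> 0" "B (x - x') r \<noteq> 0"
  shows "lightlike (\<phi> x' - w)"
proof -
  define y where "y = cone_hit x' x r"
  define y0 where "y0 = cone_hit a x r"
  have yx': "lightlike (y - x')" unfolding y_def by (rule lightlike_cone_hit_diff_vertex[OF r(1,3)])
  have xy: "lightlike (x - y)" "lightlike (x - y0)"
    unfolding y_def y0_def by (simp_all add: lightlike_diff_cone_hit[OF r(1)])
  show ?thesis
  proof (cases "lightlike (\<phi> y - \<phi> a)")
    case True
    hence "\<phi> y = w" using w xy(1) unfolding cone_focus_def by blast
    thus ?thesis using lightlike_phi[OF yx'] lightlike_diff_commute by blast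
  next
    case False
    then obtain w' where w': "cone_focus y w'" by (rule cone_focus_exists)
    have "lightlike (\<phi> y0 - \<phi> a)"
      unfolding y0_def by (intro lightlike_phi lightlike_cone_hit_diff_vertex r)
    moreover have "lightlike (y - y0)"
      unfolding y_def y0_def by (rule lightlike_cone_hit_diff_cone_hit[OF r(1)])
    ultimately have "w' = w" using w w' xy(2) unfolding cone_focus_def by metis
    thus ?thesis using w' yx' unfolding cone_focus_def by blast
  qed
qed

lemma degenerate_phi: "degenerate (\<lambda>x. B x x) \<phi>"
proof (cases "\<forall>x. lightlike (\<phi> x - \<phi> a)")
  case True
  thus ?thesis by (auto simp: degenerate_def coherency_cone_def lightlike_def)
next
  case False
  then obtain x where x: "\<not> lightlike (\<phi> x - \<phi> a)" by blast
  then obtain w where w: "cone_focus x w" by (rule cone_focus_exists)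
  have "lightlike (\<phi> x' - w)" for x'
  proof (cases "x = x'")
    case True
    thus ?thesis using w by (simp add: cone_focus_def)
  next
    case False
    have "finite {x - a, x - x'}" "0 \<notin> {x - a, x - x'}" using x False by auto
    then obtain r where "lightlike r" "\<And>u. u \<in> {x - a, x - x'} \<Longrightarrow> B u r \<noteq> 0"
      by (rule lightlike_dense_off_hyperplanes[OF _ _ dim open_UNIV UNIV_I lightlike_zero]) blast
    thus ?thesis using cone_focus_lightlike[OF w] by simp
  qed
  thus ?thesis unfolding degenerate_def coherency_cone_def lightlike_def by blast
qed

end

lemma sum_scaleR_fun_upd_add:
  fixes e :: "'i \<Rightarrow> 'a::real_vector"
  assumes "finite I" "j \<in> I"
  shows "(\<Sum>i\<in>I. (c(j := c j + k)) i *\<^sub>R e i) = (\<Sum>i\<in>I. c i *\<^sub>R e i) + k *\<^sub>R e j"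
  using assms by (simp add: sum.remove algebra_simps)

lemma span_image_imp_sum:
  assumes "finite I" "inj_on e I" "x \<in> span (e ` I)"
  obtains c where "x = (\<Sum>i\<in>I. c i *\<^sub>R e i)"
proof -
  obtain u where "x = (\<Sum>v\<in>e ` I. u v *\<^sub>R v)" using assms by (auto simp: span_finite)
  thus ?thesis using assms(2) that[of "u \<circ> e"] by (simp add: sum.reindex)
qed

lemma (in symmetric_bilinear_form) first_coordinate_of_signature:
  fixes e :: "nat \<Rightarrow> 'a"
  assumes "0 < n"
    and diagonal: "\<And>c. B (\<Sum>i<n. c i *\<^sub>R e i) (\<Sum>i<n. c i *\<^sub>R e i) = (c 0)\<^sup>2 - (\<Sum>i\<in>{1..<n}. (c i)\<^sup>2)"
  shows "B (e 0) (e 0) = 1" and "B (e 0) (\<Sum>i<n. c i *\<^sub>R e i) = c 0"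
proof -
  have polarized: "B (e 0) (e 0) + 2 * B (e 0) (\<Sum>i<n. c i *\<^sub>R e i) = (c 0 + 1)\<^sup>2 - (c 0)\<^sup>2" for c
  proof -
    let ?x = "\<Sum>i<n. c i *\<^sub>R e i"
    have "(\<Sum>i<n. (c(0 := c 0 + 1)) i *\<^sub>R e i) = ?x + e 0"
      using sum_scaleR_fun_upd_add[of "{..<n}" 0 c 1 e] \<open>0 < n\<close> by simp
    hence "B (?x + e 0) (?x + e 0) = (c 0 + 1)\<^sup>2 - (\<Sum>i\<in>{1..<n}. (c i)\<^sup>2)"
      using diagonal[of "c(0 := c 0 + 1)"] by simp
    thus ?thesis using diagonal[of c] by (simp only: form_add symmetric[of ?x "e 0"])
  qed
  show unit: "B (e 0) (e 0) = 1" using polarized[of "\<lambda>_. 0"] by (simp add: form_simps)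
  show "B (e 0) (\<Sum>i<n. c i *\<^sub>R e i) = c 0"
    using polarized[of c] unit by (simp add: power2_eq_square algebra_simps)
qed

lemma minkowski_space_lorentz_form:
  fixes q :: "'a::euclidean_space \<Rightarrow> real"
  assumes "minkowski_space q"
  obtains B e0 where "lorentz_form B e0" "q = (\<lambda>x. B x x)"
proof -
  let ?n = "DIM('a)"
  obtain B where B: "bilinear B" "\<And>x y. B x y = B y x" and "\<And>x. q x = B x x"
    using assms unfolding minkowski_space_def quadratic_form_def by blast
  hence q: "q = (\<lambda>x. B x x)" by blast
  interpret symmetric_bilinear_form B by unfold_locales (fact B)+
  obtain e :: "nat \<Rightarrow> 'a" where e: "inj_on e {..<?n}" "span (e ` {..<?n}) = UNIV"
    and diagonal: "\<And>c. q (\<Sum>i<?n. c i *\<^sub>R e i) = (c 0)\<^sup>2 - (\<Sum>i\<in>{1..<?n}. (c i)\<^sup>2)"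
    using assms unfolding minkowski_space_def has_signature_1_nm1_def by metis
  note diagonal = diagonal[unfolded q]
  note time_coordinate = first_coordinate_of_signature[OF DIM_positive diagonal]
  have "B x x < 0" if x: "B (e 0) x = 0" "x \<noteq> 0" for x
  proof -
    have "x \<in> span (e ` {..<?n})" using e(2) by simp
    then obtain c where c: "x = (\<Sum>i<?n. c i *\<^sub>R e i)"
      using span_image_imp_sum[OF finite_lessThan e(1)] by blast
    have "c 0 = 0" using time_coordinate(2)[of c] x(1) by (simp add: c)
    have "\<exists>i\<in>{1..<?n}. c i \<noteq> 0"
    proof (rule ccontr)
      assume "\<not> (\<exists>i\<in>{1..<?n}. c i \<noteq> 0)"
      hence "c i = 0" if "i < ?n" for i using \<open>c 0 = 0\<close> that by (cases "i = 0") auto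
      thus False using x(2) by (simp add: c)
    qed
    hence "(\<Sum>i\<in>{1..<?n}. (c i)\<^sup>2) > 0" by (auto intro: sum_pos2)
    thus ?thesis using diagonal[of c] \<open>c 0 = 0\<close> by (simp add: c)
  qed
  hence "lorentz_form B (e 0)" using time_coordinate(1) by unfold_locales
  thus ?thesis using that q by blast
qed

theorem theorem1p4:
  fixes q :: "'a::euclidean_space \<Rightarrow> real" and \<phi> :: "'a \<Rightarrow> 'a"
  assumes "minkowski_space q"
    and "DIM('a) > 3"
    and "continuous_on UNIV \<phi>"
    and "coherency_preserver q \<phi>"
  shows "preserves_adjacency q \<phi> \<or> degenerate q \<phi>"
proof (cases "preserves_adjacency q \<phi>")
  case False
  obtain B e0 where "lorentz_form B e0" and q: "q = (\<lambda>x. B x x)"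
    using assms(1) by (rule minkowski_space_lorentz_form)
  obtain a b where "adjacent q a b" "\<phi> b = \<phi> a"
    using False assms(4)
    unfolding preserves_adjacency_def adjacent_def coherency_preserver_def by metis
  interpret lorentz_form B e0 by fact
  interpret collapsing_preserver B e0 \<phi> a b
    using assms(2-4) \<open>adjacent q a b\<close> \<open>\<phi> b = \<phi> a\<close> unfolding q by unfold_locales simp_all
  show ?thesis using degenerate_phi q by simp
qed simp

end
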